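(* Let $a,b,c,t\ge 0$ be integers and let $u=x_1^ax_2^bx_3^cx_4^t\in S_4$. Then $u$ is a Gotzmann monomial in $S_4$ if and only if $$t\ \ge\ \binom{\binom{b}{2}}{2}+\frac{b+4}{3}\binom{b}{2}+(b+1)\binom{c+1}{2}+\binom{c+1}{3}-c.$$
   Context: Let $K$ be a field and $R_n=K[x_1,\dots,x_n]$. $S_n$ is the set of all monomials $x_1^{a_1}\cdots x_n^{a_n}$ ($a_i\in\mathbb{N}=\{0,1,2,\dots\}$) and $S_{n,d}\subset S_n$ the subset of monomials of degree $d$. $S_{n,d}$ is ordered lexicographically: $x_1^{a_1}\cdots x_n^{a_n}>x_1^{b_1}\cdots x_n^{b_n}$ iff the leftmost nonzero coordinate of $(a_1-b_1,\dots,a_n-b_n)$ is positive. A lexsegment is a set of the form $L(w)=\{v\in S_{n,d}: v\ge w\}$ with $w \in S_{n,d}$. A subset $B\subseteq S_n$ is Borel-stable if $v\in B$ implies $x_iv/x_j\in B$ for all $1\le i\le j\le n$ such that $x_j$ divides $v$. For $u\in S_n$, $B(u)$ is the smallest Borel-stable subset of $S_n$ containing $u$; if $u\in S_{n,d}$ then $B(u)\subseteq S_{n,d}$. For $B\subseteq S_{n,d}$, let $B^{lex}$ be the unique lexsegment in $S_{n,d}$ with $|B^{lex}|=|B|$, and $\mathrm{Shad}(B)=\{x_iv: v\in B,\ 1\le i\le n\}\subseteq S_{n,d+1}$. The set $B$ is a Gotzmann set if $|\mathrm{Shad}(B)|=|\mathrm{Shad}(B^{lex})|$. A monomial $u\in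 S_{n,d}$ is a Gotzmann monomial in $S_n$ if $B(u)$ is a Gotzmann set (with $\mathrm{Shad}$ and lexsegments taken in $n$ variables); equivalently, the ideal of $R_n$ generated by $B(u)$ is a Gotzmann ideal. Here $n=4$. *)

theory Defs
  imports Complex_Main "HOL-Library.Poly_Mapping"
begin

text \<open>
  The monomial \<open>x\<^sub>1^a\<^sub>1 \<cdots> x\<^sub>n^a\<^sub>n\<close> is represented by its exponent vector, a finitely
  supported function of type \<open>nat \<Rightarrow>\<^sub>0 nat\<close> whose support lies in \<open>{1..n}\<close>. The variable \<open>x\<^sub>i\<close> is
  \<open>Poly_Mapping.single i 1\<close>, and multiplication of monomials is addition of exponent vectors.
  The coefficient field plays no role in the definitions below.
\<close>

type_synonym monomial = "nat \<Rightarrow>\<^sub>0 nat"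

abbreviation var :: "nat \<Rightarrow> monomial" where
  "var i \<equiv> Poly_Mapping.single i 1"

text \<open>This is the total degree; \<open>Poly_Mapping.degree\<close> is a bound on the support instead.\<close>

definition mdeg :: "monomial \<Rightarrow> nat" where
  "mdeg v = (\<Sum>i\<in>Poly_Mapping.keys v. Poly_Mapping.lookup v i)"

definition monomials :: "nat \<Rightarrow> monomial set" where
  "monomials n = {v. Poly_Mapping.keys v \<subseteq> {1..n}}"

definition monomials_deg :: "nat \<Rightarrow> nat \<Rightarrow> monomial set" where
  "monomials_deg n d = {v \<in> monomials n. mdeg v = d}"

text \<open>
  The order \<open>\<le>\<close> on monomials is the library's linear order on \<open>nat \<Rightarrow>\<^sub>0 nat\<close>. It is the
  lexicographic order with \<open>x\<^sub>1 > x\<^sub>2 > \<cdots>\<close>: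
\<close>

lemma monomial_less_iff:
  fixes v w :: monomial
  shows "v > w \<longleftrightarrow> (\<exists>k. Poly_Mapping.lookup v k > Poly_Mapping.lookup w k \<and>
           (\<forall>i<k. Poly_Mapping.lookup v i = Poly_Mapping.lookup w i))"
  by (transfer, auto simp: less_fun_def)

definition lexsegment :: "nat \<Rightarrow> nat \<Rightarrow> monomial set \<Rightarrow> bool" where
  "lexsegment n d L \<longleftrightarrow> (\<exists>w\<in>monomials_deg n d. L = {v \<in> monomials_deg n d. v \<ge> w})"

definition borel_stable :: "nat \<Rightarrow> monomial set \<Rightarrow> bool" where
  "borel_stable n B \<longleftrightarrow> B \<subseteq> monomials n \<and>
     (\<forall>v\<in>B. \<forall>i j. 1 \<le> i \<and> i \<le> j \<and> j \<le> n \<and> Poly_Mapping.lookup v j > 0 \<longrightarrow>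
        var i + v - var j \<in> B)"

definition borel :: "nat \<Rightarrow> monomial \<Rightarrow> monomial set" where
  "borel n u = \<Inter> {B. borel_stable n B \<and> u \<in> B}"

text \<open>
  Only meaningful for nonempty \<open>B \<subseteq> monomials_deg n d\<close>, since every lexsegment is nonempty;
  see \<open>lexsegment_ex1\<close> below.
\<close>

definition lexify :: "nat \<Rightarrow> nat \<Rightarrow> monomial set \<Rightarrow> monomial set" where
  "lexify n d B = (THE L. lexsegment n d L \<and> card L = card B)"

definition shad :: "nat \<Rightarrow> monomial set \<Rightarrow> monomial set" where
  "shad n B = {var i + v | i v. v \<in> B \<and> i \<in> {1..n}}"

definition gotzmann_set :: "nat \<Rightarrow> nat \<Rightarrow> monomial set \<Rightarrow> bool" where
  "gotzmann_set n d B \<longleftrightarrow> B \<subseteq> monomials_deg n d \<and>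
     card (shad n B) = card (shad n (lexify n d B))"

definition gotzmann_monomial :: "nat \<Rightarrow> monomial \<Rightarrow> bool" where
  "gotzmann_monomial n u \<longleftrightarrow> u \<in> monomials n \<and> gotzmann_set n (mdeg u) (borel n u)"


lemma finite_monomials_deg: "finite (monomials_deg n d)"
proof -
  let ?F = "{f. \<forall>x. (x \<in> {1..n} \<longrightarrow> f x \<in> {..d}) \<and> (x \<notin> {1..n} \<longrightarrow> f x = (0::nat))}"
  have fin: "finite ?F"
    by (rule finite_set_of_finite_funs) auto
  have sub: "Poly_Mapping.lookup ` monomials_deg n d \<subseteq> ?F"
  proof safe
    fix v x assume v: "v \<in> monomials_deg n d"
    show "Poly_Mapping.lookup v x \<le> d"
    proof (cases "x \<in> Poly_Mapping.keys v")
      case True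
      then have "Poly_Mapping.lookup v x \<le> mdeg v"
        unfolding mdeg_def by (intro member_le_sum) auto
      with v show ?thesis by (simp add: monomials_deg_def)
    qed (simp add: in_keys_iff)
  next
    fix v x assume v: "v \<in> monomials_deg n d" and x: "x \<notin> {1..n}"
    from v have "Poly_Mapping.keys v \<subseteq> {1..n}"
      by (simp add: monomials_deg_def monomials_def)
    with x have "x \<notin> Poly_Mapping.keys v" by blast
    then show "Poly_Mapping.lookup v x = 0" by (simp add: in_keys_iff)
  qed
  have "inj_on Poly_Mapping.lookup (monomials_deg n d)"
    by (rule inj_onI) (simp add: poly_mapping_eqI)
  with finite_subset[OF sub fin] show ?thesis
    by (rule finite_imageD)
qed

lemma lexsegment_ex1:
  assumes "B \<subseteq> monomials_deg n d" and "B \<noteq> {}"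
  shows "\<exists>!L. lexsegment n d L \<and> card L = card B"
proof -
  have up: "\<exists>w\<in>A. card {v\<in>A. v \<ge> w} = k"
    if "finite A" "1 \<le> k" "k \<le> card A" for A :: "monomial set" and k
    using that
  proof (induction A arbitrary: k rule: finite_linorder_min_induct)
    case empty
    then show ?case by simp
  next
    case (insert b A)
    show ?case
    proof (cases "k \<le> card A")
      case True
      with insert obtain w where w: "w \<in> A" "card {v\<in>A. v \<ge> w} = k" by metis
      moreover have "{v \<in> insert b A. v \<ge> w} = {v\<in>A. v \<ge> w}"
        using insert(2) w(1) by (auto dest: leD)
      ultimately show ?thesis by (intro bexI[of _ w]) simp_all
    next
      case False
      moreover have "b \<notin> A" using insert(2) by blast
      ultimately have "k = card (insert b A)"
        using insert.prems insert(1) by simp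
      moreover have "{v \<in> insert b A. v \<ge> b} = insert b A"
        using insert(2) by (auto intro: less_imp_le)
      ultimately show ?thesis by (intro bexI[of _ b]) simp_all
    qed
  qed
  have k: "1 \<le> card B" "card B \<le> card (monomials_deg n d)"
    using assms finite_monomials_deg[of n d]
    by (auto intro: card_mono simp: Suc_le_eq card_gt_0_iff dest: finite_subset)
  from up[OF finite_monomials_deg k] have "\<exists>L. lexsegment n d L \<and> card L = card B"
    unfolding lexsegment_def by blast
  moreover have "L = L'"
    if L: "lexsegment n d L" and L': "lexsegment n d L'" and c: "card L = card L'" for L L'
  proof -
    from L L' obtain w w' where
      eq: "L = {v \<in> monomials_deg n d. v \<ge> w}" "L' = {v \<in> monomials_deg n d. v \<ge> w'}"
      unfolding lexsegment_def by blast
    then have fin: "finite L" "finite L'"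
      using finite_monomials_deg[of n d] by simp_all
    have "L \<subseteq> L' \<or> L' \<subseteq> L"
      using linear[of w w'] eq by (auto intro: order_trans)
    then show ?thesis
      using fin c card_subset_eq by metis
  qed
  ultimately show ?thesis by metis
qed

end

theory Submission
  imports Defs "HOL-Library.FuncSet"
begin

text \<open>
  Both \<open>B(u)\<close> and its lexsegment are cut out of \<open>S\<^sub>4\<^sub>,\<^sub>d\<close> by conditions on the exponents of
  \<open>x\<^sub>1, x\<^sub>2, x\<^sub>3\<close> only, and their shadows are cut out of degree \<open>d + 1\<close> by the same conditions. Hence
  \<open>u\<close> is Gotzmann iff both sets omit equally many monomials of degree \<open>d + 1\<close> not divisible by
  \<open>x\<^sub>4\<close>. Counting only monomials divisible by \<open>x\<^sub>1^a\<close>, the Borel set omits \<open>D = (b + 1 choose 2)\<close>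
  of these. Let \<open>w = x\<^sub>1^p x\<^sub>2^q x\<^sub>3^r x\<^sub>4^s\<close> be the last element of the lexsegment; comparing
  cardinalities, \<open>p \<ge> a\<close>. If \<open>p > a\<close> and the lexsegment also omits \<open>D\<close>, then comparing degree by
  degree in the first three variables shows that it omits strictly fewer monomials of degree \<open>d\<close>
  than \<open>B(u)\<close>, which is impossible. So \<open>p = a\<close> and \<open>q = D\<close>; equality of the cardinalities then
  determines \<open>r\<close>, and the only remaining condition is \<open>a + D + r \<le> d\<close>, i.e. \<open>s \<ge> 0\<close>.
\<close>

section \<open>Monomials in four variables as exponent quadruples\<close>

abbreviation lk :: "monomial \<Rightarrow> nat \<Rightarrow> nat" where
  "lk \<equiv> Poly_Mapping.lookup"

definition mon4 :: "nat \<Rightarrow> nat \<Rightarrow> nat \<Rightarrow> nat \<Rightarrow> monomial" where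
  "mon4 p q r s = Poly_Mapping.single 1 p + Poly_Mapping.single 2 q
                + Poly_Mapping.single 3 r + Poly_Mapping.single 4 s"

lemma lookup_mon4:
  "lk (mon4 p q r s) i =
    (if i = 1 then p else if i = 2 then q else if i = 3 then r else if i = 4 then s else 0)"
  by (auto simp: mon4_def lookup_add lookup_single when_def)

lemma mon4_in_monomials [simp]: "mon4 p q r s \<in> monomials 4"
  by (auto simp: monomials_def in_keys_iff lookup_mon4 split: if_splits)

lemma monomials_4E:
  assumes "v \<in> monomials 4"
  obtains p q r s where "v = mon4 p q r s"
proof
  show "v = mon4 (lk v 1) (lk v 2) (lk v 3) (lk v 4)"
  proof (rule poly_mapping_eqI)
    fix i
    have "i \<notin> {1..4} \<Longrightarrow> lk v i = 0"
      using assms by (auto simp: monomials_def in_keys_iff)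
    moreover have "i \<in> {1..4} \<longleftrightarrow> i = 1 \<or> i = 2 \<or> i = 3 \<or> i = 4" by auto
    ultimately show "lk v i = lk (mon4 (lk v 1) (lk v 2) (lk v 3) (lk v 4)) i"
      by (auto simp: lookup_mon4)
  qed
qed

lemma mdeg_eq_sum:
  assumes "v \<in> monomials n"
  shows "mdeg v = (\<Sum>i = 1..n. lk v i)"
  unfolding mdeg_def using assms
  by (intro sum.mono_neutral_left) (auto simp: monomials_def in_keys_iff)

lemma mdeg_mon4 [simp]: "mdeg (mon4 p q r s) = p + q + r + s"
proof -
  have "{1..4} = {1, 2, 3, 4::nat}" by auto
  then show ?thesis
    by (simp add: mdeg_eq_sum[OF mon4_in_monomials] lookup_mon4)
qed

lemma mon4_in_monomials_deg [simp]:
  "mon4 p q r s \<in> monomials_deg 4 d \<longleftrightarrow> p + q + r + s = d"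
  by (simp add: monomials_deg_def)

lemma monomials_deg_4E:
  assumes "v \<in> monomials_deg 4 d"
  obtains p q r s where "v = mon4 p q r s" "p + q + r + s = d"
proof -
  from assms have "v \<in> monomials 4" by (simp add: monomials_deg_def)
  then obtain p q r s where "v = mon4 p q r s" by (rule monomials_4E)
  with assms show ?thesis by (intro that[of p q r s]) auto
qed

lemma mon4_eq_iff [simp]:
  "mon4 p q r s = mon4 p' q' r' s' \<longleftrightarrow> p = p' \<and> q = q' \<and> r = r' \<and> s = s'"
proof
  assume eq: "mon4 p q r s = mon4 p' q' r' s'"
  from arg_cong[OF eq, of "\<lambda>v. lk v 1"] arg_cong[OF eq, of "\<lambda>v. lk v 2"]
    arg_cong[OF eq, of "\<lambda>v. lk v 3"] arg_cong[OF eq, of "\<lambda>v. lk v 4"]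
  show "p = p' \<and> q = q' \<and> r = r' \<and> s = s'"
    by (simp add: lookup_mon4)
qed simp

lemma mon4_less_iff:
  "mon4 p q r s < mon4 p' q' r' s' \<longleftrightarrow>
    p < p' \<or> p = p' \<and> (q < q' \<or> q = q' \<and> (r < r' \<or> r = r' \<and> s < s'))"
  (is "?L \<longleftrightarrow> ?R")
proof
  assume ?L
  then obtain k where k: "lk (mon4 p q r s) k < lk (mon4 p' q' r' s') k"
    and below: "\<And>i. i < k \<Longrightarrow> lk (mon4 p q r s) i = lk (mon4 p' q' r' s') i"
    unfolding monomial_less_iff by metis
  from k have "k = 1 \<or> k = 2 \<or> k = 3 \<or> k = 4"
    by (auto simp: lookup_mon4 split: if_splits)
  then show ?R
    using k below[of 1] below[of 2] below[of 3] by (auto simp: lookup_mon4)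
next
  assume ?R
  then consider "p < p'" | "p = p'" "q < q'" | "p = p'" "q = q'" "r < r'"
    | "p = p'" "q = q'" "r = r'" "s < s'" by blast
  then show ?L
  proof cases
    case 1
    then show ?thesis unfolding monomial_less_iff
      by (intro exI[of _ 1]) (auto simp: lookup_mon4)
  next
    case 2
    then show ?thesis unfolding monomial_less_iff
      by (intro exI[of _ 2]) (auto simp: lookup_mon4)
  next
    case 3
    then show ?thesis unfolding monomial_less_iff
      by (intro exI[of _ 3]) (auto simp: lookup_mon4)
  next
    case 4
    then show ?thesis unfolding monomial_less_iff
      by (intro exI[of _ 4]) (auto simp: lookup_mon4)
  qed
qed

lemma mon4_add_single:
  "mon4 p q r s + Poly_Mapping.single 1 k = mon4 (p + k) q r s"
  "mon4 p q r s + Poly_Mapping.single 2 k = mon4 p (q + k) r s"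
  "mon4 p q r s + Poly_Mapping.single 3 k = mon4 p q (r + k) s"
  "mon4 p q r s + Poly_Mapping.single 4 k = mon4 p q r (s + k)"
  unfolding mon4_def single_add by (simp_all only: add_ac)

lemma var_add_mon4:
  "var 1 + mon4 p q r s = mon4 (Suc p) q r s"
  "var 2 + mon4 p q r s = mon4 p (Suc q) r s"
  "var 3 + mon4 p q r s = mon4 p q (Suc r) s"
  "var 4 + mon4 p q r s = mon4 p q r (Suc s)"
  by (simp_all only: add.commute[of "var _"] mon4_add_single Suc_eq_plus1)

lemma mon4_minus_var:
  "mon4 p q r s - var 1 = mon4 (p - 1) q r s"
  "mon4 p q r s - var 2 = mon4 p (q - 1) r s"
  "mon4 p q r s - var 3 = mon4 p q (r - 1) s"
  "mon4 p q r s - var 4 = mon4 p q r (s - 1)"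
  by (simp_all add: poly_mapping_eq_iff fun_eq_iff lookup_minus lookup_single lookup_mon4)

section \<open>Sets cut out by the first three exponents, and their shadows\<close>

definition slice :: "(nat \<Rightarrow> nat \<Rightarrow> nat \<Rightarrow> bool) \<Rightarrow> nat \<Rightarrow> monomial set" where
  "slice P d = {v \<in> monomials_deg 4 d. P (lk v 1) (lk v 2) (lk v 3)}"

text \<open>The pair \<open>(x, y)\<close> stands for \<open>x\<^sub>1^x x\<^sub>2^y x\<^sub>3^(e - x - y)\<close>. Taking \<open>e\<close> to be the degree in the first
  three variables decomposes a slice of degree \<open>d\<close> into the faces with \<open>e \<le> d\<close>.\<close>

definition face :: "(nat \<Rightarrow> nat \<Rightarrow> nat \<Rightarrow> bool) \<Rightarrow> nat \<Rightarrow> (nat \<times> nat) set" where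
  "face P e = {(x, y). x + y \<le> e \<and> P x y (e - x - y)}"

lemma mon4_in_slice [simp]:
  "mon4 p q r s \<in> slice P d \<longleftrightarrow> p + q + r + s = d \<and> P p q r"
  by (simp add: slice_def lookup_mon4)

lemma sliceE:
  assumes "v \<in> slice P d"
  obtains p q r s where "v = mon4 p q r s" "p + q + r + s = d" "P p q r"
proof -
  from assms have "v \<in> monomials_deg 4 d" by (simp add: slice_def)
  then obtain p q r s where "v = mon4 p q r s" by (rule monomials_deg_4E)
  with assms show ?thesis by (intro that[of p q r s]) auto
qed

lemma finite_slice [simp]: "finite (slice P d)"
  using finite_monomials_deg[of 4 d] by (simp add: slice_def)

lemma finite_face [simp]: "finite (face P e)"
  by (rule finite_subset[of _ "{..e} \<times> {..e}"]) (auto simp: face_def)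

lemma card_slice: "card (slice P d) = (\<Sum>e\<le>d. card (face P e))"
proof -
  let ?f = "\<lambda>(e, x, y). mon4 x y (e - x - y) (d - e)"
  let ?g = "\<lambda>v. (d - lk v 4, lk v 1, lk v 2)"
  have "bij_betw ?f (Sigma {..d} (face P)) (slice P d)"
  proof (rule bij_betwI[where g = ?g])
    show "?f \<in> Sigma {..d} (face P) \<rightarrow> slice P d"
      by (auto simp: face_def)
  next
    show "?g \<in> slice P d \<rightarrow> Sigma {..d} (face P)"
    proof
      fix v assume "v \<in> slice P d"
      then obtain p q r s where "v = mon4 p q r s" "p + q + r + s = d" "P p q r"
        by (rule sliceE)
      then show "?g v \<in> Sigma {..d} (face P)"
        by (auto simp: face_def lookup_mon4)
    qed
  next
    fix w assume "w \<in> Sigma {..d} (face P)"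
    then show "?g (?f w) = w"
      by (cases w) (simp add: face_def lookup_mon4)
  next
    fix v assume "v \<in> slice P d"
    then obtain p q r s where "v = mon4 p q r s" "p + q + r + s = d" "P p q r"
      by (rule sliceE)
    then show "?f (?g v) = v" by (auto simp: lookup_mon4)
  qed
  then have "card (slice P d) = card (Sigma {..d} (face P))"
    by (rule bij_betw_same_card[symmetric])
  then show ?thesis by simp
qed

text \<open>Multiplication by \<open>x\<^sub>4\<close> maps the smaller slice onto the part of the
  larger one divisible by \<open>x\<^sub>4\<close>; the last face counts the rest.\<close>

lemma card_slice_Suc: "card (slice P (Suc d)) = card (slice P d) + card (face P (Suc d))"
  by (simp add: card_slice)

lemma card_face_diff:
  assumes "\<And>x y z. P x y z \<Longrightarrow> Q x y z"
  shows "card (face Q e) = card (face P e) + card (face (\<lambda>x y z. Q x y z \<and> \<not> P x y z) e)"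
proof -
  have "face Q e = face P e \<union> face (\<lambda>x y z. Q x y z \<and> \<not> P x y z) e"
    using assms by (auto simp: face_def)
  moreover have "face P e \<inter> face (\<lambda>x y z. Q x y z \<and> \<not> P x y z) e = {}"
    by (auto simp: face_def)
  ultimately show ?thesis by (simp add: card_Un_disjoint)
qed

text \<open>The second hypothesis deals with the monomials of degree \<open>d + 1\<close> not divisible by \<open>x\<^sub>4\<close>.\<close>

lemma shad_slice:
  assumes up: "\<And>x y z. P x y z \<Longrightarrow> P (Suc x) y z \<and> P x (Suc y) z \<and> P x y (Suc z)"
    and down: "\<And>x y z. P x y z \<Longrightarrow> x + y + z = Suc d \<Longrightarrow>
      (\<exists>x'. x = Suc x' \<and> P x' y z) \<or> (\<exists>y'. y = Suc y' \<and> P x y' z) \<or> (\<exists>z'. z = Suc z' \<and> P x y z')"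
  shows "shad 4 (slice P d) = slice P (Suc d)"
proof
  have idx: "i \<in> {1..4} \<longleftrightarrow> i = 1 \<or> i = 2 \<or> i = 3 \<or> i = 4" for i :: nat by auto
  show "shad 4 (slice P d) \<subseteq> slice P (Suc d)"
    unfolding shad_def idx using up by (auto elim!: sliceE simp: var_add_mon4 simp del: One_nat_def)
  have shadI: "var i + v \<in> shad 4 (slice P d)" if "v \<in> slice P d" "i \<in> {1..4}" for i v
    using that by (auto simp: shad_def)
  show "slice P (Suc d) \<subseteq> shad 4 (slice P d)"
  proof
    fix v assume "v \<in> slice P (Suc d)"
    then obtain p q r s where v: "v = mon4 p q r s" "p + q + r + s = Suc d" "P p q r"
      by (rule sliceE)
    show "v \<in> shad 4 (slice P d)"
    proof (cases s)
      case (Suc s')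
      with v shadI[of "mon4 p q r s'" 4] show ?thesis by (simp add: var_add_mon4 del: One_nat_def)
    next
      case 0
      with v down[of p q r] consider
          p' where "p = Suc p'" "P p' q r" | q' where "q = Suc q'" "P p q' r"
        | r' where "r = Suc r'" "P p q r'" by auto
      then show ?thesis
      proof cases
        case 1
        with v shadI[of "mon4 p' q r s" 1] show ?thesis
          by (simp add: var_add_mon4 del: One_nat_def)
      next
        case 2
        with v shadI[of "mon4 p q' r s" 2] show ?thesis by (simp add: var_add_mon4 del: One_nat_def)
      next
        case 3
        with v shadI[of "mon4 p q r' s" 3] show ?thesis by (simp add: var_add_mon4 del: One_nat_def)
      qed
    qed
  qed
qed

section \<open>The Borel set and its shadow\<close>

lemma borel_stable_shift:
  assumes "borel_stable n B" "1 \<le> i" "i \<le> j" "j \<le> n"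
    and "v + Poly_Mapping.single j k \<in> B"
  shows "v + Poly_Mapping.single i k \<in> B"
  using assms(5)
proof (induction k arbitrary: v)
  case 0
  then show ?case by simp
next
  case (Suc k)
  have "var i + (v + Poly_Mapping.single j (Suc k)) - var j \<in> B"
    using assms(1-4) Suc.prems
    by (auto simp: borel_stable_def lookup_add)
  moreover have "var i + (v + Poly_Mapping.single j (Suc k)) - var j
      = (v + var i) + Poly_Mapping.single j k"
    by (rule poly_mapping_eqI) (auto simp: lookup_add lookup_minus lookup_single when_def)
  ultimately have "(v + var i) + Poly_Mapping.single i k \<in> B"
    using Suc.IH by simp
  moreover have "(v + var i) + Poly_Mapping.single i k = v + Poly_Mapping.single i (Suc k)"
    by (rule poly_mapping_eqI) (auto simp: lookup_add lookup_single when_def)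
  ultimately show ?case by simp
qed

text \<open>Borel moves never lower a partial sum of the exponents. The fourth partial sum is the
  degree, which is fixed, so three inequalities remain.\<close>

definition dominates :: "nat \<Rightarrow> nat \<Rightarrow> nat \<Rightarrow> nat \<Rightarrow> nat \<Rightarrow> nat \<Rightarrow> bool" where
  "dominates a b c x y z \<longleftrightarrow> a \<le> x \<and> a + b \<le> x + y \<and> a + b + c \<le> x + y + z"

lemma borel_mon4: "borel 4 (mon4 a b c t) = slice (dominates a b c) (a + b + c + t)"
proof
  have "borel_stable 4 (slice (dominates a b c) (a + b + c + t))"
    unfolding borel_stable_def
  proof (intro conjI ballI allI impI)
    show "slice (dominates a b c) (a + b + c + t) \<subseteq> monomials 4"
      by (auto simp: slice_def monomials_deg_def)
  next
    fix v i j
    assume v: "v \<in> slice (dominates a b c) (a + b + c + t)"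
      and ij: "1 \<le> i \<and> i \<le> j \<and> j \<le> 4 \<and> 0 < lk v j"
    obtain p q r s where pqrs: "v = mon4 p q r s" "p + q + r + s = a + b + c + t"
      "dominates a b c p q r" using v by (rule sliceE)
    have "i = 1 \<or> i = 2 \<or> i = 3 \<or> i = 4" "j = 1 \<or> j = 2 \<or> j = 3 \<or> j = 4"
      using ij by auto
    then show "var i + v - var j \<in> slice (dominates a b c) (a + b + c + t)"
      using ij pqrs(2,3) unfolding pqrs(1) dominates_def
      by (elim disjE)
        (simp_all add: var_add_mon4 mon4_minus_var lookup_mon4 dominates_def del: One_nat_def)
  qed
  then show "borel 4 (mon4 a b c t) \<subseteq> slice (dominates a b c) (a + b + c + t)"
    unfolding borel_def by (auto simp: dominates_def)
  show "slice (dominates a b c) (a + b + c + t) \<subseteq> borel 4 (mon4 a b c t)"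
  proof
    fix v assume "v \<in> slice (dominates a b c) (a + b + c + t)"
    then obtain p q r s where v: "v = mon4 p q r s" "p + q + r + s = a + b + c + t"
      "dominates a b c p q r" by (rule sliceE)
    show "v \<in> borel 4 (mon4 a b c t)"
      unfolding borel_def
    proof (rule InterI, safe)
      fix B assume B: "borel_stable 4 B" and u: "mon4 a b c t \<in> B"
      note dom = v(2,3)[unfolded dominates_def]
      \<comment> \<open>The surpluses of the partial sums of \<open>v\<close> over those of
        \<open>mon4 a b c t\<close> tell how many factors to move from \<open>x\<^sub>4\<close> to
        \<open>x\<^sub>3\<close>, then from \<open>x\<^sub>3\<close> to \<open>x\<^sub>2\<close>,
        then from \<open>x\<^sub>2\<close> to \<open>x\<^sub>1\<close>. In this order each move
        finds enough factors to consume.\<close>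
      define k3 k2 k1 where "k3 = p + q + r - (a + b + c)" and "k2 = p + q - (a + b)"
        and "k1 = p - a"
      have k: "t = s + k3" "c + k3 = r + k2" "b + k2 = q + k1" "a + k1 = p"
        using dom by (auto simp: k3_def k2_def k1_def)
      have "mon4 a b (c + k3) s \<in> B"
        using borel_stable_shift[OF B, of 3 4 "mon4 a b c s" k3] u
        by (simp add: mon4_add_single k(1))
      then have "mon4 a (b + k2) r s \<in> B"
        using borel_stable_shift[OF B, of 2 3 "mon4 a b r s" k2]
        by (simp add: mon4_add_single k(2))
      then have "mon4 (a + k1) q r s \<in> B"
        using borel_stable_shift[OF B, of 1 2 "mon4 a q r s" k1]
        by (simp add: mon4_add_single k(3) del: One_nat_def)
      then show "v \<in> B" by (simp add: k(4) v(1))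
    qed
  qed
qed

text \<open>The last of the first three variables that occurs can be divided out: every partial sum
  this lowers equals the full degree \<open>Suc (a + b + c + t)\<close>, so it has room to drop by
  one.\<close>

lemma shad_dominates:
  "shad 4 (slice (dominates a b c) (a + b + c + t)) = slice (dominates a b c) (Suc (a + b + c + t))"
proof (rule shad_slice)
  fix x y z assume P: "dominates a b c x y z" and deg: "x + y + z = Suc (a + b + c + t)"
  consider z' where "z = Suc z'" | y' where "z = 0" "y = Suc y'"
    | x' where "z = 0" "y = 0" "x = Suc x'" using deg by (cases z; cases y; cases x) auto
  then show "(\<exists>x'. x = Suc x' \<and> dominates a b c x' y z) \<or> (\<exists>y'. y = Suc y' \<and> dominates a b c x y' z)
      \<or> (\<exists>z'. z = Suc z' \<and> dominates a b c x y z')"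
    using P deg by cases (auto simp: dominates_def)
qed (auto simp: dominates_def)

section \<open>The lexsegment and its shadow\<close>

text \<open>In a fixed degree, agreement in three exponents forces agreement in the fourth, so a tie
  needs no further clause.\<close>

definition lex_ge :: "nat \<Rightarrow> nat \<Rightarrow> nat \<Rightarrow> nat \<Rightarrow> nat \<Rightarrow> nat \<Rightarrow> bool" where
  "lex_ge p q r x y z \<longleftrightarrow> p < x \<or> p = x \<and> (q < y \<or> q = y \<and> r \<le> z)"

lemma upper_set_mon4:
  assumes "p + q + r + s = d"
  shows "{v \<in> monomials_deg 4 d. v \<ge> mon4 p q r s} = slice (lex_ge p q r) d"
proof (rule set_eqI)
  fix v
  show "v \<in> {v \<in> monomials_deg 4 d. v \<ge> mon4 p q r s} \<longleftrightarrow> v \<in> slice (lex_ge p q r) d"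
  proof (cases "v \<in> monomials_deg 4 d")
    case True
    then obtain p' q' r' s' where v: "v = mon4 p' q' r' s'" "p' + q' + r' + s' = d"
      by (rule monomials_deg_4E)
    have "mon4 p q r s \<le> v \<longleftrightarrow> lex_ge p q r p' q' r'"
      using assms v(2) unfolding v(1) le_less mon4_less_iff mon4_eq_iff lex_ge_def by arith
    with v show ?thesis by simp
  qed (simp add: slice_def)
qed

text \<open>Again the last variable that occurs is divided out. The bound
  \<open>p + q + r \<le> d\<close> keeps the quotient above the threshold when the earlier exponents
  tie.\<close>

lemma shad_lex_ge:
  assumes "p + q + r \<le> d"
  shows "shad 4 (slice (lex_ge p q r) d) = slice (lex_ge p q r) (Suc d)"
proof (rule shad_slice)
  fix x y z assume P: "lex_ge p q r x y z" and deg: "x + y + z = Suc d"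
  consider z' where "z = Suc z'" | y' where "z = 0" "y = Suc y'"
    | x' where "z = 0" "y = 0" "x = Suc x'" using deg by (cases z; cases y; cases x) auto
  then show "(\<exists>x'. x = Suc x' \<and> lex_ge p q r x' y z) \<or> (\<exists>y'. y = Suc y' \<and> lex_ge p q r x y' z)
      \<or> (\<exists>z'. z = Suc z' \<and> lex_ge p q r x y z')"
    using P deg assms by cases (auto simp: lex_ge_def)
qed (auto simp: lex_ge_def)

section \<open>Counting the omitted monomials\<close>

lemma card_triangle: "card {(x, y). a \<le> x \<and> x + y < a + n} = Suc n choose 2"
proof -
  \<comment> \<open>Here \<open>i\<close> is the excess of \<open>x + y\<close> over
    \<open>a\<close>, and \<open>j\<close> that of \<open>x\<close>; each \<open>i\<close> admits
    \<open>i + 1\<close> values of \<open>j\<close>.\<close>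
  have "bij_betw (\<lambda>(i, j). (a + j, i - j)) (Sigma {..<n} (\<lambda>i. {..i})) {(x, y). a \<le> x \<and> x + y < a + n}"
    by (rule bij_betwI[where g = "\<lambda>(x, y). (x + y - a, x - a)"]) auto
  then have "card {(x, y). a \<le> x \<and> x + y < a + n} = card (Sigma {..<n} (\<lambda>i. {..i}))"
    by (rule bij_betw_same_card[symmetric])
  also have "\<dots> = (\<Sum>i<n. Suc i)" by simp
  also have "\<dots> = Suc n choose 2"
    by (induction n) (auto simp: numeral_2_eq_2)
  finally show ?thesis .
qed

text \<open>Faces below degree \<open>a\<close> are empty; the later ones are triangles, which
  Pascal's rule adds up to a tetrahedral number.\<close>

lemma sum_card_face_ge:
  "(\<Sum>e<a + n. card (face (\<lambda>x y z. a \<le> x) e)) = Suc (Suc n) choose 3"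
proof (induction n)
  case 0
  have "face (\<lambda>x y z. a \<le> x) e = {}" if "e < a" for e
    using that by (auto simp: face_def)
  then show ?case by (simp add: numeral_3_eq_3)
next
  case (Suc n)
  have "face (\<lambda>x y z. a \<le> x) (a + n) = {(x, y). a \<le> x \<and> x + y < a + Suc n}"
    by (auto simp: face_def)
  then have "card (face (\<lambda>x y z. a \<le> x) (a + n)) = Suc (Suc n) choose 2"
    by (simp only: card_triangle)
  with Suc show ?case by (simp add: numeral_3_eq_3 numeral_2_eq_2)
qed

lemma sum_atMost_split:
  fixes f :: "nat \<Rightarrow> nat"
  assumes "m \<le> Suc d"
  shows "(\<Sum>e\<le>d. f e) = (\<Sum>e<m. f e) + (\<Sum>e = m..d. f e)"
proof -
  have "{..d} = {..<m} \<union> {m..d}" using assms by auto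
  then show ?thesis by (simp only:) (rule sum.union_disjoint; auto)
qed

text \<open>Complements are taken inside the multiples of \<open>x\<^sub>1^a\<close>, which contain
  the Borel set and, once \<open>a \<le> p\<close>, the lexsegment. Equal sizes then mean equal
  complements.\<close>

definition not_dom :: "nat \<Rightarrow> nat \<Rightarrow> nat \<Rightarrow> nat \<Rightarrow> nat \<Rightarrow> nat \<Rightarrow> bool" where
  "not_dom a b c x y z \<longleftrightarrow> a \<le> x \<and> \<not> dominates a b c x y z"

definition not_lex :: "nat \<Rightarrow> nat \<Rightarrow> nat \<Rightarrow> nat \<Rightarrow> nat \<Rightarrow> nat \<Rightarrow> nat \<Rightarrow> bool" where
  "not_lex a p q r x y z \<longleftrightarrow> a \<le> x \<and> \<not> lex_ge p q r x y z"

lemma card_face_dominates: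
  "card (face (\<lambda>x y z. a \<le> x) e)
    = card (face (dominates a b c) e) + card (face (not_dom a b c) e)"
  using card_face_diff[of "dominates a b c" "\<lambda>x y z. a \<le> x" e]
  by (simp add: dominates_def not_dom_def[abs_def])

lemma card_face_lex_ge:
  assumes "a \<le> p"
  shows "card (face (\<lambda>x y z. a \<le> x) e)
    = card (face (lex_ge p q r) e) + card (face (not_lex a p q r) e)"
proof -
  have "a \<le> x" if "lex_ge p q r x y z" for x y z
    using that assms by (auto simp: lex_ge_def)
  from card_face_diff[of "lex_ge p q r" "\<lambda>x y z. a \<le> x", OF this]
  show ?thesis by (simp add: not_lex_def[abs_def])
qed

text \<open>On the face of degree \<open>e\<close> the third inequality of \<open>dominates\<close>
  reads \<open>a + b + c \<le> e\<close>: below this bound everything is omitted, above it only a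
  triangle independent of \<open>e\<close>.\<close>

lemma face_not_dom_low:
  assumes "e < a + b + c"
  shows "face (not_dom a b c) e = face (\<lambda>x y z. a \<le> x) e"
  using assms by (auto simp: face_def not_dom_def dominates_def)

lemma card_face_not_dom_high:
  assumes "a + b + c \<le> e"
  shows "card (face (not_dom a b c) e) = Suc b choose 2"
proof -
  have "face (not_dom a b c) e = {(x, y). a \<le> x \<and> x + y < a + b}"
    using assms by (auto simp: face_def not_dom_def dominates_def)
  then show ?thesis by (simp only: card_triangle)
qed

lemma sum_card_face_not_dom:
  "(\<Sum>e\<le>a + b + c + t. card (face (not_dom a b c) e))
    = (Suc (Suc (b + c)) choose 3) + Suc t * (Suc b choose 2)"
proof -
  have "(\<Sum>e<a + b + c. card (face (not_dom a b c) e)) = Suc (Suc (b + c)) choose 3"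
    using sum_card_face_ge[of a "b + c"] by (simp add: face_not_dom_low add.assoc)
  moreover have "(\<Sum>e = a + b + c..a + b + c + t. card (face (not_dom a b c) e))
      = Suc t * (Suc b choose 2)"
    by (simp add: card_face_not_dom_high)
  ultimately show ?thesis
    by (simp add: sum_atMost_split[of "a + b + c"])
qed

text \<open>The omitted pairs are \<open>(a, y)\<close> with \<open>y < q\<close>, and
  \<open>(a, q)\<close> as long as its third exponent \<open>e - a - q\<close> is below
  \<open>r\<close>. Truncated subtraction gives the correct value 0 when
  \<open>e < a\<close>.\<close>

lemma card_face_not_lex:
  "card (face (not_lex a a q r) e)
    = (if e < a + q then Suc e - a else q + (if e < a + q + r then 1 else 0))"
proof -
  consider "e < a + q" | "a + q \<le> e" "e < a + q + r" | "a + q + r \<le> e" by linarith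
  then show ?thesis
  proof cases
    case 1
    then have "face (not_lex a a q r) e = Pair a ` {..<Suc e - a}"
      by (auto simp: face_def not_lex_def lex_ge_def)
    with 1 show ?thesis by (simp add: card_image inj_on_def)
  next
    case 2
    then have "face (not_lex a a q r) e = Pair a ` {..<Suc q}"
      by (auto simp: face_def not_lex_def lex_ge_def)
    with 2 show ?thesis by (simp add: card_image inj_on_def)
  next
    case 3
    then have "face (not_lex a a q r) e = Pair a ` {..<q}"
      by (auto simp: face_def not_lex_def lex_ge_def)
    with 3 show ?thesis by (simp add: card_image inj_on_def)
  qed
qed

text \<open>The extra pair \<open>(a, q)\<close> occurs in exactly \<open>r\<close> degrees, all at
  most \<open>d\<close> by hypothesis. Thus \<open>r\<close> enters linearly and can be solved
  for.\<close>

lemma sum_card_face_not_lex: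
  assumes "a + q + r \<le> d"
  shows "(\<Sum>e\<le>d. card (face (not_lex a a q r) e)) = (Suc q choose 2) + (Suc d - a - q) * q + r"
proof -
  have "(\<Sum>e<a + q. card (face (not_lex a a q r) e)) = (\<Sum>e<a + q. Suc e - a)"
    by (simp add: card_face_not_lex)
  also have "\<dots> = Suc q choose 2"
    by (induction q) (auto simp: numeral_2_eq_2)
  finally have low: "(\<Sum>e<a + q. card (face (not_lex a a q r) e)) = Suc q choose 2" .
  have "(\<Sum>e = a + q..d. card (face (not_lex a a q r) e))
      = (\<Sum>e = a + q..d. q + (if e < a + q + r then 1 else 0))"
    by (simp add: card_face_not_lex)
  also have "\<dots> = (Suc d - a - q) * q + card {e \<in> {a + q..d}. e < a + q + r}"
    by (simp add: sum.distrib flip: sum.inter_filter)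
  also have "{e \<in> {a + q..d}. e < a + q + r} = {a + q..<a + q + r}"
    using assms by auto
  finally show ?thesis
    using low assms by (simp add: sum_atMost_split[of "a + q"])
qed

text \<open>For \<open>e \<ge> a + b + c\<close> the Borel set omits the same number \<open>D\<close> of pairs in every degree \<open>e\<close>.
  The lexsegment omits \<open>D\<close> pairs in degree \<open>d + 1\<close>, one of which is \<open>(a, d + 1 - a)\<close> because
  \<open>a < p\<close>. That pair drops out in lower degrees, where at most \<open>(p, q)\<close> can replace it, and not even
  that in degree \<open>d\<close>.\<close>

lemma sum_card_face_less:
  assumes "a < p" and deg: "p + q + r \<le> d" "a + b + c \<le> d"
    and growth: "card (face (not_lex a p q r) (Suc d)) = Suc b choose 2"
  shows "(\<Sum>e\<le>d. card (face (not_lex a p q r) e)) < (\<Sum>e\<le>d. card (face (not_dom a b c) e))"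
proof -
  let ?F = "face (not_lex a p q r)"
  let ?G = "?F (Suc d) - {(a, Suc d - a)}"
  have "(a, Suc d - a) \<in> ?F (Suc d)"
    using \<open>a < p\<close> deg by (auto simp: face_def not_lex_def lex_ge_def)
  then have G: "Suc (card ?G) = Suc b choose 2"
    using growth by (metis card_Suc_Diff1 finite_face)
  have sub: "?F e \<subseteq> insert (p, q) ?G" if "e \<le> d" for e
    using that by (auto simp: face_def not_lex_def lex_ge_def)
  have "(p, q) \<notin> ?F d"
    using deg by (auto simp: face_def not_lex_def lex_ge_def)
  with sub[of d] have "?F d \<subseteq> ?G" by blast
  then have "card (?F d) \<le> card ?G" by (intro card_mono) auto
  with G have strict: "card (?F d) < card (face (not_dom a b c) d)"
    using deg by (simp add: card_face_not_dom_high)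
  have "card (?F e) \<le> card (face (not_dom a b c) e)" if "e \<le> d" for e
  proof (cases "e < a + b + c")
    case True
    \<comment> \<open>In these low degrees the Borel condition omits every multiple of
      \<open>x\<^sub>1^a\<close>, the largest possible number.\<close>
    have "?F e \<subseteq> face (\<lambda>x y z. a \<le> x) e" by (auto simp: face_def not_lex_def)
    with True show ?thesis by (simp add: face_not_dom_low card_mono)
  next
    case False
    have "card (?F e) \<le> card (insert (p, q) ?G)"
      using sub[OF that] by (intro card_mono) auto
    also have "\<dots> \<le> Suc (card ?G)" by (rule card_insert_le_m1) auto
    finally show ?thesis using False G by (simp add: card_face_not_dom_high)
  qed
  with strict show ?thesis by (intro sum_strict_mono_ex1) auto
qed

section \<open>Reduction to one equation for the last lexsegment element\<close>

text \<open>The witness \<open>r\<close> is the exponent of \<open>x\<^sub>3\<close> in the last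
  element of the lexsegment. The equation says that both sets omit equally many monomials, and the
  inequality leaves a nonnegative exponent for \<open>x\<^sub>4\<close>.\<close>

lemma gotzmann_mon4_iff:
  fixes a b c t :: nat
  defines "D \<equiv> Suc b choose 2"
  shows "gotzmann_monomial 4 (mon4 a b c t) \<longleftrightarrow>
    (\<exists>r. D + r \<le> b + c + t \<and>
      (Suc D choose 2) + (Suc (b + c + t) - D) * D + r = (Suc (Suc (b + c)) choose 3) + Suc t * D)"
    (is "_ \<longleftrightarrow> (\<exists>r. ?R r)")
proof -
  define d where "d = a + b + c + t"
  define B where "B = slice (dominates a b c) d"
  have lex: "lexsegment 4 d (slice (lex_ge p q r) d)" if "p + q + r \<le> d" for p q r
    unfolding lexsegment_def using that upper_set_mon4[of p q r "d - p - q - r" d]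
    by (intro bexI[of _ "mon4 p q r (d - p - q - r)"]) auto
  have B_sub: "B \<subseteq> monomials_deg 4 d" by (auto simp: B_def slice_def)
  moreover have "mon4 a b c t \<in> B" by (simp add: B_def d_def dominates_def)
  ultimately have ex1: "\<exists>!L. lexsegment 4 d L \<and> card L = card B"
    by (intro lexsegment_ex1) auto
  have shad_B: "shad 4 B = slice (dominates a b c) (Suc d)"
    by (simp add: B_def d_def shad_dominates)
  have gotz: "gotzmann_monomial 4 (mon4 a b c t) \<longleftrightarrow> card (shad 4 B) = card (shad 4 (lexify 4 d B))"
    using B_sub by (simp add: gotzmann_monomial_def gotzmann_set_def borel_mon4 B_def d_def)
  \<comment> \<open>Once the sizes in degree \<open>d\<close> agree, the shadows can differ in size
    only through their faces of degree \<open>Suc d\<close>.\<close>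
  have growth_iff: "card (shad 4 B) = card (shad 4 (slice (lex_ge p q r) d)) \<longleftrightarrow>
      card (face (not_lex a p q r) (Suc d)) = D"
    if "card (slice (lex_ge p q r) d) = card B" "a \<le> p" "p + q + r \<le> d" for p q r
  proof -
    have "card (face (not_dom a b c) (Suc d)) = D"
      by (simp add: card_face_not_dom_high D_def d_def)
    then show ?thesis
      using that(1)[unfolded B_def] card_face_dominates[of a "Suc d" b c]
        card_face_lex_ge[OF that(2), of "Suc d" q r]
      unfolding shad_B shad_lex_ge[OF that(3)] card_slice_Suc by linarith
  qed
  have size_iff: "card (slice (lex_ge p q r) d) = card B \<longleftrightarrow>
      (\<Sum>e\<le>d. card (face (not_lex a p q r) e)) = (\<Sum>e\<le>d. card (face (not_dom a b c) e))"
    if "a \<le> p" for p q r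
  proof -
    \<comment> \<open>Both sides count the monomials of degree \<open>d\<close> divisible by
      \<open>x\<^sub>1^a\<close>.\<close>
    have "card B + (\<Sum>e\<le>d. card (face (not_dom a b c) e))
        = card (slice (lex_ge p q r) d) + (\<Sum>e\<le>d. card (face (not_lex a p q r) e))"
      unfolding B_def card_slice sum.distrib[symmetric]
      using that by (simp flip: card_face_dominates card_face_lex_ge)
    then show ?thesis by linarith
  qed
  have size_a: "card (slice (lex_ge a D r) d) = card B \<longleftrightarrow>
      (Suc D choose 2) + (Suc (b + c + t) - D) * D + r = (Suc (Suc (b + c)) choose 3) + Suc t * D"
    if "a + D + r \<le> d" for r
  proof -
    have "Suc d - a = Suc (b + c + t)" by (simp add: d_def)
    then show ?thesis
      using that sum_card_face_not_dom[of a b c t]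
      by (simp add: size_iff sum_card_face_not_lex D_def flip: d_def del: binomial_Suc_Suc)
  qed
  show ?thesis
  proof
    assume "\<exists>r. ?R r"
    then obtain r where r: "?R r" by blast
    then have deg: "a + D + r \<le> d" by (simp add: d_def)
    then have size: "card (slice (lex_ge a D r) d) = card B"
      using r size_a by blast
    then have "lexify 4 d B = slice (lex_ge a D r) d"
      unfolding lexify_def using lex[OF deg] by (intro the1_equality[OF ex1]) auto
    moreover have "card (face (not_lex a a D r) (Suc d)) = D"
      using deg by (simp add: card_face_not_lex)
    ultimately show "gotzmann_monomial 4 (mon4 a b c t)"
      using gotz growth_iff[OF size _ deg] by simp
  next
    assume "gotzmann_monomial 4 (mon4 a b c t)"
    then have shads: "card (shad 4 B) = card (shad 4 (lexify 4 d B))" by (simp add: gotz)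
    have "lexsegment 4 d (lexify 4 d B) \<and> card (lexify 4 d B) = card B"
      unfolding lexify_def by (rule theI'[OF ex1])
    then obtain w where w: "w \<in> monomials_deg 4 d" "lexify 4 d B = {v \<in> monomials_deg 4 d. v \<ge> w}"
      "card (lexify 4 d B) = card B"
      unfolding lexsegment_def by blast
    obtain p q r s where pqrs: "w = mon4 p q r s" "p + q + r + s = d"
      using w(1) by (rule monomials_deg_4E)
    then have deg: "p + q + r \<le> d" by simp
    have L: "lexify 4 d B = slice (lex_ge p q r) d"
      using w(2) pqrs upper_set_mon4 by simp
    with w have size: "card (slice (lex_ge p q r) d) = card B" by simp
    have "a \<le> p"
    proof (rule ccontr)
      assume "\<not> a \<le> p"
      \<comment> \<open>If \<open>p < a\<close>, every element of \<open>B\<close> exceeds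
        \<open>w\<close> already in the first exponent, while \<open>w\<close> itself lies outside
        \<open>B\<close>.\<close>
      then have "B \<subseteq> slice (lex_ge p q r) d"
        by (auto elim!: sliceE simp: B_def dominates_def lex_ge_def)
      moreover have "w \<in> slice (lex_ge p q r) d" "w \<notin> B"
        using \<open>\<not> a \<le> p\<close> pqrs by (auto simp: B_def dominates_def lex_ge_def)
      ultimately have "card B < card (slice (lex_ge p q r) d)"
        by (intro psubset_card_mono) auto
      with size show False by simp
    qed
    then have growth: "card (face (not_lex a p q r) (Suc d)) = D"
      using growth_iff[OF size _ deg] shads L by simp
    have "\<not> a < p"
      using sum_card_face_less[of a p q r d b c] deg growth size size_iff[OF \<open>a \<le> p\<close>]
      by (auto simp: D_def d_def)
    with \<open>a \<le> p\<close> have "p = a" by simp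
    \<comment> \<open>Degree \<open>Suc d\<close> exceeds \<open>a + q + r\<close>, so the face
      count is exactly \<open>q\<close>.\<close>
    moreover have "q = D"
      using growth deg by (simp add: \<open>p = a\<close> card_face_not_lex)
    ultimately have "?R r"
      using size size_a[of r] deg by (auto simp: d_def)
    then show "\<exists>r. ?R r" ..
  qed
qed

section \<open>Closed form of the bound\<close>

lemma real_choose_2: "real (n choose 2) = real n * (real n - 1) / 2"
  by (induction n) (auto simp: numeral_2_eq_2 field_simps)

lemma real_choose_3: "real (n choose 3) = real n * (real n - 1) * (real n - 2) / 6"
proof (induction n)
  case (Suc n)
  have "real (Suc n choose 3) = real (n choose 2) + real (n choose 3)"
    by (simp add: numeral_3_eq_3 numeral_2_eq_2)
  then show ?case unfolding Suc real_choose_2 by (simp add: field_simps)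
qed simp

theorem theorem7p7:
  fixes a b c t :: nat
  defines "u \<equiv> Poly_Mapping.single 1 a + Poly_Mapping.single 2 b
             + Poly_Mapping.single 3 c + Poly_Mapping.single 4 t"
  shows "gotzmann_monomial 4 u \<longleftrightarrow>
    real t \<ge> real ((b choose 2) choose 2) + (real b + 4) / 3 * real (b choose 2)
             + (real b + 1) * real ((c + 1) choose 2) + real ((c + 1) choose 3) - real c"
    (is "_ \<longleftrightarrow> ?N \<le> real t")
proof -
  define D where "D = Suc b choose 2"
  define n where "n = b + c + t"
  \<comment> \<open>\<open>R\<close> is the only candidate for \<open>r\<close>; the claimed bound
    is a rearrangement of \<open>D + R \<le> n\<close>.\<close>
  define R where "R = ?N + real (b + c) - real D"
  have D: "real D = real b * (real b + 1) / 2"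
    by (simp add: D_def real_choose_2 del: binomial_Suc_Suc)
  have R: "R = real b * (real b + 1) * (real b - 1) * (3 * real b - 2) / 24
      + (real b + 1) * (real c * (real c + 1) / 2) + (real c + 1) * real c * (real c - 1) / 6"
    unfolding R_def D real_choose_2 real_choose_3 by (simp add: field_simps)
  have "R \<ge> 0"
  proof -
    have "real m * (real m - 1) \<ge> 0" for m by (cases m) auto
    then have b: "real b * (real b - 1) \<ge> 0" and c: "real c * (real c - 1) \<ge> 0" by blast+
    have "real b * (real b + 1) * (real b - 1) * (3 * real b - 2) \<ge> 0"
    \<comment> \<open>The factor \<open>3 * real b - 2\<close> is negative only for
      \<open>b = 0\<close>, where the product vanishes.\<close>
    proof (cases "b = 0")
      case False
      then have "(real b * (real b - 1)) * ((real b + 1) * (3 * real b - 2)) \<ge> 0"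
        using b by (intro mult_nonneg_nonneg) auto
      then show ?thesis by (simp add: mult_ac)
    qed simp
    moreover have "(real c + 1) * real c * (real c - 1) \<ge> 0"
      using mult_nonneg_nonneg[OF _ c, of "real c + 1"] by (simp add: mult_ac)
    ultimately show ?thesis unfolding R by simp
  qed
  \<comment> \<open>This is the cardinality equation solved for \<open>r\<close>; unlike the closed
    form it shows that \<open>R\<close> is an integer.\<close>
  have R': "R = real (Suc (Suc (b + c)) choose 3) - real D * real (b + c) + real D * (real D - 1) / 2"
    unfolding R D real_choose_3 by (simp add: field_simps)
  have eq_iff: "(Suc D choose 2) + (Suc n - D) * D + r = (Suc (Suc (b + c)) choose 3) + Suc t * D
      \<longleftrightarrow> real r = R" if "D + r \<le> n" for r
  proof -
    have "real ((Suc D choose 2) + (Suc n - D) * D + r)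
        = (real D + 1) * real D / 2 + (real n + 1 - real D) * real D + real r"
      \<comment> \<open>The bound \<open>D + r \<le> n\<close> makes the natural subtraction
        \<open>Suc n - D\<close> exact.\<close>
      using that by (simp add: real_choose_2 of_nat_diff add.commute del: binomial_Suc_Suc)
    moreover have "real ((Suc (Suc (b + c)) choose 3) + Suc t * D)
        = real (Suc (Suc (b + c)) choose 3) + (real t + 1) * real D"
      by (simp add: algebra_simps del: binomial_Suc_Suc)
    ultimately have "real ((Suc D choose 2) + (Suc n - D) * D + r)
        - real ((Suc (Suc (b + c)) choose 3) + Suc t * D) = real r - R"
      unfolding R' n_def by (simp add: field_simps del: binomial_Suc_Suc)
    then show ?thesis by linarith
  qed
  have "gotzmann_monomial 4 u \<longleftrightarrow> (\<exists>r. D + r \<le> n \<and> real r = R)"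
    using gotzmann_mon4_iff[of a b c t] eq_iff
    unfolding u_def mon4_def D_def n_def by blast
  also have "\<dots> \<longleftrightarrow> ?N \<le> real t"
  proof
    assume "\<exists>r. D + r \<le> n \<and> real r = R"
    then obtain r where "D + r \<le> n" "real r = R" by blast
    then have "real D + R \<le> real n" by (metis of_nat_add of_nat_le_iff)
    then show "?N \<le> real t" by (simp add: R_def n_def)
  next
    assume N: "?N \<le> real t"
    \<comment> \<open>Being an integer and nonnegative, \<open>R\<close> is a natural number and can
      serve as \<open>r\<close>.\<close>
    have "R = of_int (int (Suc (Suc (b + c)) choose 3) - int D * int (b + c) + int (D choose 2))"
      unfolding R' by (simp add: real_choose_2 del: binomial_Suc_Suc)
    with \<open>R \<ge> 0\<close> obtain r where r: "real r = R"
      by (metis of_int_0_le_iff of_int_of_nat_eq zero_le_imp_eq_int)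
    have "real D + real r \<le> real n"
      using N by (simp add: r R_def n_def)
    then have "D + r \<le> n" by (metis of_nat_add of_nat_le_iff)
    with r show "\<exists>r. D + r \<le> n \<and> real r = R" by blast
  qed
  finally show ?thesis .
qed

end
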